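(* Let $V\subseteq\mathbb{R}$ be a closed subset, $k\ge 1$, let $F:V^k\to V$ be continuous, and let $T:V^k\to V^k$ be given by $T(x_1,\ldots,x_k)=(F(x_1,\ldots,x_k),x_1,\ldots,x_{k-1})$. Suppose $G:V^k\times V^k\to V^k\times V^k$ is a diagonal extension of $T$, and there is a monotonic ordering $\leq_\tau$ on $V^k$ such that $G$ is increasing with respect to the associated order $\leq_\lambda$ on $V^k\times V^k$. Assume there are $P,Q\in V^k\times V^k$ with $P\leq_\lambda G(P)$ and $G(Q)\leq_\lambda Q$. If $G$ has a unique fixed point in $[P,Q]=\{Z\in V^k\times V^k: P\leq_\lambda Z\leq_\lambda Q\}$, then $G^n(Y_0)$ converges as $n\to\infty$ for all $Y_0=(X_0,X_0)$, $X_0\in V^k$, that satisfy $P\leq_\lambda Y_0\leq_\lambda Q$. In that case, the sequence defined by $x_{n+1}=F(x_n,\ldots,x_{n-k+1})$, $n\ge 0$, with initial condition $(x_0,x_{-1},\ldots,x_{-k+1})=X_0$, converges to a fixed point of $F$.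
   Context: For a map $\tau:\{1,\ldots,k\}\to\{-1,1\}$, the monotonic ordering $\leq_\tau$ on $V^k$ is: $(x_1,\ldots,x_k)\leq_\tau(y_1,\ldots,y_k)$ iff for all $i$, $x_i\le y_i$ when $\tau(i)=1$ and $x_i\ge y_i$ when $\tau(i)=-1$. The associated order $\leq_\lambda$ on $V^k\times V^k$ is: $(X_1,U_1)\leq_\lambda(X_2,U_2)$ iff $X_1\leq_\tau X_2$ and $U_2\leq_\tau U_1$. A map $G$ between posets is increasing if $Z\le W$ implies $G(Z)\le G(W)$. A diagonal extension of $T$ to $V^k\times V^k$ is a map $G:V^k\times V^k\to V^k\times V^k$ with $G(X,X)=(T(X),T(X))$ for all $X\in V^k$. A point $x\in V$ is a fixed point of $F:V^k\to V$ if $F(x,\ldots,x)=x$. *)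

theory Defs
  imports "HOL-Analysis.Analysis"
begin

text \<open>
  A point \<open>(x\<^sub>1, \<dots>, x\<^sub>k)\<close> of \<open>V\<^sup>k\<close> is an extensional function on \<open>{1..k}\<close>, i.e. its value
  outside \<open>{1..k}\<close> is \<open>undefined\<close>; hence equality in \<open>V\<^sup>k\<close> is equality of functions. The
  topology of the type \<open>nat \<Rightarrow> real\<close> is the product topology, and the subspace topology it
  induces on this set is the usual topology of \<open>V\<^sup>k\<close>.
\<close>

definition tuples :: "real set \<Rightarrow> nat \<Rightarrow> (nat \<Rightarrow> real) set" where
  "tuples V k = (\<Pi>\<^sub>E i\<in>{1..k}. V)"

definition shift_map ::
    "nat \<Rightarrow> ((nat \<Rightarrow> real) \<Rightarrow> real) \<Rightarrow> (nat \<Rightarrow> real) \<Rightarrow> (nat \<Rightarrow> real)" where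
  "shift_map k F X = (\<lambda>i\<in>{1..k}. if i = 1 then F X else X (i - 1))"

definition le_tau ::
    "nat \<Rightarrow> (nat \<Rightarrow> int) \<Rightarrow> (nat \<Rightarrow> real) \<Rightarrow> (nat \<Rightarrow> real) \<Rightarrow> bool" where
  "le_tau k \<tau> X Y \<longleftrightarrow>
     (\<forall>i\<in>{1..k}. (\<tau> i = 1 \<longrightarrow> X i \<le> Y i) \<and> (\<tau> i = -1 \<longrightarrow> X i \<ge> Y i))"

definition le_lambda ::
    "nat \<Rightarrow> (nat \<Rightarrow> int) \<Rightarrow> (nat \<Rightarrow> real) \<times> (nat \<Rightarrow> real) \<Rightarrow> (nat \<Rightarrow> real) \<times> (nat \<Rightarrow> real) \<Rightarrow> bool" where
  "le_lambda k \<tau> Z W \<longleftrightarrow> le_tau k \<tau> (fst Z) (fst W) \<and> le_tau k \<tau> (snd W) (snd Z)"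

definition order_interval ::
    "real set \<Rightarrow> nat \<Rightarrow> (nat \<Rightarrow> int) \<Rightarrow> (nat \<Rightarrow> real) \<times> (nat \<Rightarrow> real) \<Rightarrow>
     (nat \<Rightarrow> real) \<times> (nat \<Rightarrow> real) \<Rightarrow> ((nat \<Rightarrow> real) \<times> (nat \<Rightarrow> real)) set" where
  "order_interval V k \<tau> P Q =
     {Z \<in> tuples V k \<times> tuples V k. le_lambda k \<tau> P Z \<and> le_lambda k \<tau> Z Q}"

definition diagonal_extension ::
    "real set \<Rightarrow> nat \<Rightarrow> ((nat \<Rightarrow> real) \<Rightarrow> (nat \<Rightarrow> real)) \<Rightarrow>
     ((nat \<Rightarrow> real) \<times> (nat \<Rightarrow> real) \<Rightarrow> (nat \<Rightarrow> real) \<times> (nat \<Rightarrow> real)) \<Rightarrow> bool" where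
  "diagonal_extension V k T G \<longleftrightarrow>
     G \<in> tuples V k \<times> tuples V k \<rightarrow> tuples V k \<times> tuples V k \<and>
     (\<forall>X\<in>tuples V k. G (X, X) = (T X, T X))"

definition fixed_point_of ::
    "real set \<Rightarrow> nat \<Rightarrow> ((nat \<Rightarrow> real) \<Rightarrow> real) \<Rightarrow> real \<Rightarrow> bool" where
  "fixed_point_of V k F x \<longleftrightarrow> x \<in> V \<and> F (\<lambda>i\<in>{1..k}. x) = x"

text \<open>
  The sequence \<open>(x\<^sub>n)\<close>, \<open>n \<ge> 1 - k\<close>, is indexed by integers; its values at indices below
  \<open>1 - k\<close> are irrelevant. The \<open>i\<close>-th component of \<open>(x\<^sub>n, \<dots>, x\<^bsub>n-k+1\<^esub>)\<close> is \<open>x\<^bsub>n+1-i\<^esub>\<close>.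
\<close>

definition solves_recurrence ::
    "nat \<Rightarrow> ((nat \<Rightarrow> real) \<Rightarrow> real) \<Rightarrow> (nat \<Rightarrow> real) \<Rightarrow> (int \<Rightarrow> real) \<Rightarrow> bool" where
  "solves_recurrence k F X\<^sub>0 x \<longleftrightarrow>
     (\<lambda>i\<in>{1..k}. x (1 - int i)) = X\<^sub>0 \<and>
     (\<forall>n\<ge>0. x (n + 1) = F (\<lambda>i\<in>{1..k}. x (n + 1 - int i)))"

end

theory Submission
  imports Defs
begin

text \<open>
  Since \<open>G\<close> need not be continuous, the monotone orbits of \<open>P\<close> and \<open>Q\<close> may stop short of a fixed
  point, so the orbit of \<open>(X\<^sub>0, X\<^sub>0)\<close> is not simply squeezed between them. Instead let \<open>\<Omega>\<close> be the
  set of subsequential limits of \<open>T\<^sup>n X\<^sub>0\<close>. The orbit is trapped in a compact box and \<open>T\<close> is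
  continuous, so \<open>\<Omega> \<noteq> {}\<close> and \<open>T \<Omega> = \<Omega>\<close>; hence \<open>G\<close> maps the set of lower bounds of the diagonal
  copy of \<open>\<Omega>\<close> into itself. A Knaster-Tarski argument produces a fixed point of \<open>G\<close> between \<open>P\<close>
  and all points \<open>(w, w)\<close>, \<open>w \<in> \<Omega>\<close>, and dually one between these points and \<open>Q\<close>. The two
  fixed points coincide by uniqueness, so \<open>\<Omega>\<close> is a singleton and the orbit converges.
\<close>

section \<open>The two orders, their suprema, and fixed points of monotone maps\<close>

lemma le_tau_uminus: "le_tau k (\<lambda>i. - \<tau> i) X Y \<longleftrightarrow> le_tau k \<tau> Y X"
proof -
  have "- \<tau> i = 1 \<longleftrightarrow> \<tau> i = -1" "- \<tau> i = -1 \<longleftrightarrow> \<tau> i = 1" for i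
    by linarith+
  then show ?thesis
    unfolding le_tau_def by blast
qed

text \<open>Negating \<open>\<tau>\<close> reverses the order, so facts about suprema, lower bounds
  and fixed points dualise by instantiation instead of a second proof.\<close>

lemma le_lambda_uminus: "le_lambda k (\<lambda>i. - \<tau> i) Z W \<longleftrightarrow> le_lambda k \<tau> W Z"
  by (auto simp: le_lambda_def le_tau_uminus)

lemma le_tau_trans: "le_tau k \<tau> X Y \<Longrightarrow> le_tau k \<tau> Y Z \<Longrightarrow> le_tau k \<tau> X Z"
  by (fastforce simp: le_tau_def)

lemma le_lambda_trans: "le_lambda k \<tau> Z W \<Longrightarrow> le_lambda k \<tau> W U \<Longrightarrow> le_lambda k \<tau> Z U"
  by (auto simp: le_lambda_def intro: le_tau_trans)

lemma le_tau_antisym: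
  assumes "\<tau> \<in> {1..k} \<rightarrow> {-1, 1}" "X \<in> tuples V k" "Y \<in> tuples V k"
    and "le_tau k \<tau> X Y" "le_tau k \<tau> Y X"
  shows "X = Y"
proof (rule PiE_ext)
  show "X \<in> (\<Pi>\<^sub>E i\<in>{1..k}. V)" "Y \<in> (\<Pi>\<^sub>E i\<in>{1..k}. V)"
    using assms(2,3) by (simp_all add: tuples_def)
  show "X i = Y i" if "i \<in> {1..k}" for i
  proof -
    have "\<tau> i = 1 \<or> \<tau> i = -1"
      using assms(1) that by blast
    then show ?thesis
      using assms(4,5) that by (fastforce simp: le_tau_def)
  qed
qed

lemma le_lambda_antisym:
  assumes "\<tau> \<in> {1..k} \<rightarrow> {-1, 1}" "Z \<in> tuples V k \<times> tuples V k" "W \<in> tuples V k \<times> tuples V k"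
    and "le_lambda k \<tau> Z W" "le_lambda k \<tau> W Z"
  shows "Z = W"
proof (rule prod_eqI)
  show "fst Z = fst W" "snd Z = snd W"
    using assms by (auto simp: le_lambda_def intro: le_tau_antisym[OF assms(1)])
qed

text \<open>Suprema are taken coordinatewise, with infima replacing them where \<open>\<tau>\<close>
  is -1. The bound \<open>B\<close> makes each coordinate set bounded on the relevant side, and
  closedness of \<open>V\<close> keeps the extremum in \<open>V\<close>.\<close>

lemma le_tau_lub:
  assumes "closed V" "\<tau> \<in> {1..k} \<rightarrow> {-1, 1}" "A \<subseteq> tuples V k" "A \<noteq> {}"
    and B: "\<And>X. X \<in> A \<Longrightarrow> le_tau k \<tau> X B"
  obtains S where "S \<in> tuples V k" "\<And>X. X \<in> A \<Longrightarrow> le_tau k \<tau> X S"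
    "\<And>U. (\<And>X. X \<in> A \<Longrightarrow> le_tau k \<tau> X U) \<Longrightarrow> le_tau k \<tau> S U"
proof
  define S where
    "S = (\<lambda>i\<in>{1..k}. if \<tau> i = 1 then Sup ((\<lambda>X. X i) ` A) else Inf ((\<lambda>X. X i) ` A))"
  have V: "(\<lambda>X. X i) ` A \<subseteq> V" if "i \<in> {1..k}" for i
    using assms(3) that by (fastforce simp: tuples_def)
  have above: "bdd_above ((\<lambda>X. X i) ` A)" if "i \<in> {1..k}" "\<tau> i = 1" for i
    using B that by (intro bdd_aboveI[of _ "B i"]) (auto simp: le_tau_def)
  have below: "bdd_below ((\<lambda>X. X i) ` A)" if "i \<in> {1..k}" "\<tau> i = -1" for i
    using B that by (intro bdd_belowI[of _ "B i"]) (auto simp: le_tau_def)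
  have "S i \<in> V" if i: "i \<in> {1..k}" for i
  proof -
    consider "\<tau> i = 1" | "\<tau> i = -1"
      using assms(2) i by blast
    then show ?thesis
    proof cases
      case 1
      then show ?thesis
        using closed_subset_contains_Sup[OF assms(1) V[OF i] _ above[OF i]] assms(4) i
        by (simp add: S_def)
    next
      case 2
      then show ?thesis
        using closed_subset_contains_Inf[OF assms(1) V[OF i] _ below[OF i]] assms(4) i
        by (simp add: S_def)
    qed
  qed
  then show "S \<in> tuples V k"
    by (auto simp: tuples_def S_def)
  show "le_tau k \<tau> X S" if "X \<in> A" for X
    using that above below by (auto simp: le_tau_def S_def intro!: cSUP_upper cINF_lower)
  show "le_tau k \<tau> S U" if "\<And>X. X \<in> A \<Longrightarrow> le_tau k \<tau> X U" for U
    using that assms(4) by (auto simp: le_tau_def S_def intro!: cSUP_least cINF_greatest)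
qed

text \<open>\<open>le_lambda\<close> is the product of \<open>le_tau\<close> with its reverse. A
  supremum therefore pairs a supremum of first components with an infimum of second components; the
  latter comes from \<open>le_tau_lub\<close> for the negated \<open>\<tau>\<close>.\<close>

lemma le_lambda_lub:
  assumes "closed V" "\<tau> \<in> {1..k} \<rightarrow> {-1, 1}" "A \<subseteq> tuples V k \<times> tuples V k" "A \<noteq> {}"
    and B: "\<And>Z. Z \<in> A \<Longrightarrow> le_lambda k \<tau> Z B"
  obtains S where "S \<in> tuples V k \<times> tuples V k" "\<And>Z. Z \<in> A \<Longrightarrow> le_lambda k \<tau> Z S"
    "\<And>U. (\<And>Z. Z \<in> A \<Longrightarrow> le_lambda k \<tau> Z U) \<Longrightarrow> le_lambda k \<tau> S U"
proof -
  obtain S1 where S1: "S1 \<in> tuples V k" "\<And>X. X \<in> fst ` A \<Longrightarrow> le_tau k \<tau> X S1"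
    "\<And>U. (\<And>X. X \<in> fst ` A \<Longrightarrow> le_tau k \<tau> X U) \<Longrightarrow> le_tau k \<tau> S1 U"
    using assms by (elim le_tau_lub[of V \<tau> k "fst ` A" "fst B"]) (auto simp: le_lambda_def)
  have neg: "(\<lambda>i. - \<tau> i) \<in> {1..k} \<rightarrow> {-1, 1}"
    using assms(2) by (auto simp: Pi_iff)
  obtain S2 where S2: "S2 \<in> tuples V k" "\<And>X. X \<in> snd ` A \<Longrightarrow> le_tau k \<tau> S2 X"
    "\<And>U. (\<And>X. X \<in> snd ` A \<Longrightarrow> le_tau k \<tau> U X) \<Longrightarrow> le_tau k \<tau> U S2"
  proof (rule le_tau_lub[OF assms(1) neg, of "snd ` A" "snd B", unfolded le_tau_uminus])
    show "snd ` A \<subseteq> tuples V k" "snd ` A \<noteq> {}"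
      using assms(3,4) by auto
    show "le_tau k \<tau> (snd B) X" if "X \<in> snd ` A" for X
      using that B by (auto simp: le_lambda_def)
  qed (rule that, blast+)
  show thesis
  proof (rule that[of "(S1, S2)"])
    show "(S1, S2) \<in> tuples V k \<times> tuples V k"
      using S1(1) S2(1) by simp
    show "le_lambda k \<tau> Z (S1, S2)" if "Z \<in> A" for Z
      using that S1(2) S2(2) by (auto simp: le_lambda_def)
    show "le_lambda k \<tau> (S1, S2) U" if "\<And>Z. Z \<in> A \<Longrightarrow> le_lambda k \<tau> Z U" for U
      unfolding le_lambda_def using that
      by (auto simp: le_lambda_def intro!: S1(3) S2(3))
  qed
qed

text \<open>Knaster-Tarski, where a set \<open>D \<subseteq> G ` D\<close> plays the role of an upper bound \<open>B\<close> with \<open>G B \<le> B\<close>.\<close>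

lemma fixed_point_below:
  assumes "closed V" and \<tau>: "\<tau> \<in> {1..k} \<rightarrow> {-1, 1}"
    and G: "G \<in> tuples V k \<times> tuples V k \<rightarrow> tuples V k \<times> tuples V k"
    and mono: "monotone_on (tuples V k \<times> tuples V k) (le_lambda k \<tau>) (le_lambda k \<tau>) G"
    and P: "P \<in> tuples V k \<times> tuples V k" "le_lambda k \<tau> P (G P)"
    and D: "D \<subseteq> tuples V k \<times> tuples V k" "D \<noteq> {}" "D \<subseteq> G ` D"
    and PD: "\<And>W. W \<in> D \<Longrightarrow> le_lambda k \<tau> P W"
  obtains Z where "Z \<in> tuples V k \<times> tuples V k" "G Z = Z" "le_lambda k \<tau> P Z"
    "\<And>W. W \<in> D \<Longrightarrow> le_lambda k \<tau> Z W"
proof -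
  let ?VV = "tuples V k \<times> tuples V k"
  \<comment> \<open>The candidates are the points that \<open>G\<close> moves up and that lie below
    all of \<open>D\<close>; their supremum \<open>S\<close> will be the fixed point.\<close>
  define A where "A = {Z \<in> ?VV. le_lambda k \<tau> Z (G Z) \<and> (\<forall>W\<in>D. le_lambda k \<tau> Z W)}"
  have GVV: "G Z \<in> ?VV" if "Z \<in> ?VV" for Z
    using G that by (rule funcset_mem)
  have monoD: "le_lambda k \<tau> (G Z) (G W)" if "Z \<in> ?VV" "W \<in> ?VV" "le_lambda k \<tau> Z W" for Z W
    using mono that by (rule monotone_onD)
  have "P \<in> A"
    using P PD by (simp add: A_def)
  obtain B where "B \<in> D"
    using D(2) by blast
  obtain S where S: "S \<in> ?VV" "\<And>Z. Z \<in> A \<Longrightarrow> le_lambda k \<tau> Z S"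
    "\<And>U. (\<And>Z. Z \<in> A \<Longrightarrow> le_lambda k \<tau> Z U) \<Longrightarrow> le_lambda k \<tau> S U"
  proof (rule le_lambda_lub[OF assms(1) \<tau>, of A B])
    show "A \<subseteq> ?VV" "A \<noteq> {}"
      using \<open>P \<in> A\<close> by (auto simp: A_def)
    show "le_lambda k \<tau> Z B" if "Z \<in> A" for Z
      using that \<open>B \<in> D\<close> by (simp add: A_def)
  qed (rule that, blast+)
  have SD: "le_lambda k \<tau> S W" if "W \<in> D" for W
    using that by (intro S(3)) (simp add: A_def)
  have SG: "le_lambda k \<tau> S (G S)"
  proof (rule S(3))
    fix Z assume "Z \<in> A"
    then have "le_lambda k \<tau> Z (G Z)" "le_lambda k \<tau> (G Z) (G S)"
      using monoD S(1,2) by (simp_all add: A_def)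
    then show "le_lambda k \<tau> Z (G S)"
      by (rule le_lambda_trans)
  qed
  have "le_lambda k \<tau> (G S) W" if "W \<in> D" for W
  proof -
    obtain W' where W': "W' \<in> D" "W = G W'"
      using \<open>W \<in> D\<close> D(3) by blast
    then show ?thesis
      using monoD[OF S(1) _ SD] D(1) by blast
  qed
  then have "G S \<in> A"
    using GVV[OF S(1)] monoD[OF S(1) _ SG] by (simp add: A_def)
  then have "G S = S"
    using le_lambda_antisym[OF \<tau> GVV S(1) S(2) SG] S(1) by blast
  then show thesis
    using that S(1) S(2)[OF \<open>P \<in> A\<close>] SD by blast
qed

text \<open>Follows from \<open>fixed_point_below\<close> for the negated \<open>\<tau>\<close>:
  reversing the order on both sides leaves \<open>G\<close> monotone and turns \<open>Q\<close> into
  a lower bound.\<close>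

lemma fixed_point_above:
  assumes "closed V" and \<tau>: "\<tau> \<in> {1..k} \<rightarrow> {-1, 1}"
    and G: "G \<in> tuples V k \<times> tuples V k \<rightarrow> tuples V k \<times> tuples V k"
    and mono: "monotone_on (tuples V k \<times> tuples V k) (le_lambda k \<tau>) (le_lambda k \<tau>) G"
    and Q: "Q \<in> tuples V k \<times> tuples V k" "le_lambda k \<tau> (G Q) Q"
    and D: "D \<subseteq> tuples V k \<times> tuples V k" "D \<noteq> {}" "D \<subseteq> G ` D"
    and QD: "\<And>W. W \<in> D \<Longrightarrow> le_lambda k \<tau> W Q"
  obtains Z where "Z \<in> tuples V k \<times> tuples V k" "G Z = Z" "le_lambda k \<tau> Z Q"
    "\<And>W. W \<in> D \<Longrightarrow> le_lambda k \<tau> W Z"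
proof -
  have neg: "(\<lambda>i. - \<tau> i) \<in> {1..k} \<rightarrow> {-1, 1}"
    using \<tau> by (auto simp: Pi_iff)
  have "monotone_on (tuples V k \<times> tuples V k)
      (le_lambda k (\<lambda>i. - \<tau> i)) (le_lambda k (\<lambda>i. - \<tau> i)) G"
    using mono unfolding monotone_on_def le_lambda_uminus by blast
  from fixed_point_below[OF assms(1) neg G this Q(1) _ D] Q(2) QD that show thesis
    unfolding le_lambda_uminus by blast
qed

section \<open>Topology of tuples and continuity of the shift map\<close>

lemma tendsto_coordinate:
  fixes y :: "nat \<Rightarrow> 'a \<Rightarrow> 'b::topological_space"
  assumes "y \<longlonglongrightarrow> w"
  shows "(\<lambda>n. y n i) \<longlonglongrightarrow> w i"
  using continuous_on_tendsto_compose[OF continuous_on_product_coordinates assms] by simp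

lemma le_tau_lim:
  assumes "y \<longlonglongrightarrow> w" "\<And>n. le_tau k \<tau> A (y n)"
  shows "le_tau k \<tau> A w"
  unfolding le_tau_def
proof (intro ballI conjI impI)
  fix i assume i: "i \<in> {1..k}"
  note lim = tendsto_coordinate[OF assms(1), of i]
  show "A i \<le> w i" if "\<tau> i = 1"
    using i that assms(2) by (intro LIMSEQ_le_const[OF lim]) (auto simp: le_tau_def)
  show "w i \<le> A i" if "\<tau> i = -1"
    using i that assms(2) by (intro LIMSEQ_le_const2[OF lim]) (auto simp: le_tau_def)
qed

text \<open>An extensional product is a full product whose factors outside \<open>I\<close> are the
  compact singleton \<open>{undefined}\<close>, so Tychonoff's theorem applies.\<close>

lemma compact_PiE:
  fixes S :: "'a \<Rightarrow> 'b::topological_space set"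
  assumes "\<And>i. i \<in> I \<Longrightarrow> compact (S i)"
  shows "compact (\<Pi>\<^sub>E i\<in>I. S i)"
proof -
  have "(\<Pi>\<^sub>E i\<in>I. S i) = (\<Pi>\<^sub>E i\<in>UNIV. if i \<in> I then S i else {undefined})"
    by (auto simp: PiE_iff extensional_def split: if_splits)
  then show ?thesis
    using assms by (simp add: compactin_PiE flip: euclidean_product_topology compactin_euclidean_iff)
qed

lemma continuous_on_shift_map:
  assumes "continuous_on A F"
  shows "continuous_on A (shift_map k F)"
proof (rule continuous_on_coordinatewise_then_product)
  fix i
  show "continuous_on A (\<lambda>X. shift_map k F X i)"
    using assms continuous_on_subset[OF continuous_on_product_coordinates]
    by (cases "i \<in> {1..k}"; cases "i = 1") (auto simp: shift_map_def)
qed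

lemma shift_map_in_tuples:
  assumes "F \<in> tuples V k \<rightarrow> V" "X \<in> tuples V k"
  shows "shift_map k F X \<in> tuples V k"
proof -
  have "F X \<in> V"
    using assms by (rule funcset_mem)
  moreover have "X (i - 1) \<in> V" if "i \<in> {1..k}" "i \<noteq> 1" for i
  proof -
    have "i - 1 \<in> {1..k}"
      using that by auto
    then show ?thesis
      using assms(2) unfolding tuples_def by (rule PiE_mem[rotated])
  qed
  ultimately show ?thesis
    by (auto simp: shift_map_def tuples_def)
qed

section \<open>Subsequential limits (omega-limit sets) of sequences in a compact set\<close>

definition subseq_limits :: "(nat \<Rightarrow> 'a::topological_space) \<Rightarrow> 'a set" where
  "subseq_limits y = {w. \<exists>r. strict_mono r \<and> (y \<circ> r) \<longlonglongrightarrow> w}"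

lemma subseq_limits_subset:
  assumes "closed K" "\<And>n. y n \<in> K"
  shows "subseq_limits y \<subseteq> K"
proof
  fix w assume "w \<in> subseq_limits y"
  then obtain r where "(y \<circ> r) \<longlonglongrightarrow> w"
    by (auto simp: subseq_limits_def)
  then show "w \<in> K"
    using assms by (auto intro: closed_sequentially[of K "y \<circ> r"])
qed

text \<open>The parameter \<open>r\<close> allows a limit point to be extracted along prescribed
  indices: all indices for nonemptiness, indices of terms far from a supposed limit, or predecessors
  of given indices.\<close>

lemma seq_compact_imp_subseq_limit:
  assumes "seq_compact K" "\<And>n. y n \<in> K" "strict_mono (r :: nat \<Rightarrow> nat)"
  obtains s w where "strict_mono s" "(y \<circ> r \<circ> s) \<longlonglongrightarrow> w" "w \<in> subseq_limits y"
proof -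
  obtain w s where "strict_mono s" "(y \<circ> r \<circ> s) \<longlonglongrightarrow> w"
    using seq_compactE[OF assms(1), of "y \<circ> r"] assms(2) by (metis comp_apply)
  then show thesis
    using that strict_mono_o[OF assms(3)] by (auto simp: subseq_limits_def comp_assoc)
qed

text \<open>Without convergence, infinitely many terms avoid some open neighbourhood of
  \<open>z\<close>. By compactness they have a limit point in its closed complement, which cannot be
  \<open>z\<close>.\<close>

lemma tendsto_if_subseq_limits_singleton:
  assumes "seq_compact K" "\<And>n. y n \<in> K" "subseq_limits y \<subseteq> {z}"
  shows "y \<longlonglongrightarrow> z"
proof (rule ccontr)
  assume "\<not> y \<longlonglongrightarrow> z"
  then obtain U where U: "open U" "z \<in> U" "\<not> eventually (\<lambda>n. y n \<in> U) sequentially"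
    by (auto simp: tendsto_def)
  then have "infinite {n. y n \<notin> U}"
    by (simp add: not_eventually frequently_cofinite flip: cofinite_eq_sequentially)
  then obtain r :: "nat \<Rightarrow> nat" where r: "strict_mono r" "\<And>n. y (r n) \<notin> U"
    using infinite_enumerate by blast
  obtain s w where s: "(y \<circ> r \<circ> s) \<longlonglongrightarrow> w" "w \<in> subseq_limits y"
    by (rule seq_compact_imp_subseq_limit[of K y r, OF assms(1,2) r(1)])
  then have "w = z"
    using assms(3) by blast
  have "w \<in> - U"
    using U(1) r(2) by (intro closed_sequentially[OF _ _ s(1)]) auto
  then show False
    using U(2) \<open>w = z\<close> by simp
qed

text \<open>Stepping back once along a subsequence tending to \<open>w\<close> gives a sequence of
  predecessors. Compactness supplies a limit point \<open>w'\<close> of these, and continuity yields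
  \<open>T w' = w\<close>.\<close>

lemma subseq_limits_preimage:
  fixes y :: "nat \<Rightarrow> 'a::t2_space"
  assumes "seq_compact K" "closed K" "\<And>n. y n \<in> K" "continuous_on K T" "\<And>n. y (Suc n) = T (y n)"
  shows "subseq_limits y \<subseteq> T ` subseq_limits y"
proof
  fix w assume "w \<in> subseq_limits y"
  then obtain r where r: "strict_mono r" "(y \<circ> r) \<longlonglongrightarrow> w"
    by (auto simp: subseq_limits_def)
  \<comment> \<open>The index \<open>r 0\<close> may be 0 and have no predecessor; starting at
    \<open>Suc n\<close> makes the truncated subtraction exact.\<close>
  have pos: "Suc (r (Suc n) - 1) = r (Suc n)" for n
    using strict_mono_less[OF r(1), of n "Suc n"] by simp
  have "strict_mono (\<lambda>n. r (Suc n) - 1)"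
  proof (rule strict_monoI_Suc)
    fix n
    have "r (Suc n) < r (Suc (Suc n))"
      using r(1) by (simp add: strict_mono_Suc_iff)
    then show "r (Suc n) - 1 < r (Suc (Suc n)) - 1"
      using pos[of n] by linarith
  qed
  then obtain s w' where s: "strict_mono s" "(y \<circ> (\<lambda>n. r (Suc n) - 1) \<circ> s) \<longlonglongrightarrow> w'"
      "w' \<in> subseq_limits y"
    by (rule seq_compact_imp_subseq_limit[of K y, OF assms(1,3)])
  have "w' \<in> K"
    using s(3) subseq_limits_subset[of K y, OF assms(2,3)] by blast
  then have "(\<lambda>n. T (y (r (Suc (s n)) - 1))) \<longlonglongrightarrow> T w'"
    using s(2) assms(3) by (intro continuous_on_tendsto_compose[OF assms(4)]) (auto simp: o_def)
  moreover have "(\<lambda>n. y (r (Suc (s n)))) \<longlonglongrightarrow> w"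
    using LIMSEQ_subseq_LIMSEQ[OF LIMSEQ_Suc[OF r(2)] s(1)] by (simp add: o_def)
  ultimately have "w = T w'"
    unfolding assms(5)[symmetric] pos by (rule LIMSEQ_unique[rotated])
  then show "w \<in> T ` subseq_limits y"
    using s(3) by blast
qed

section \<open>Convergence of the diagonal orbit and of the recurrence\<close>

theorem theorem2p5:
  fixes V :: "real set" and k :: nat
    and F :: "(nat \<Rightarrow> real) \<Rightarrow> real"
    and G :: "(nat \<Rightarrow> real) \<times> (nat \<Rightarrow> real) \<Rightarrow> (nat \<Rightarrow> real) \<times> (nat \<Rightarrow> real)"
    and \<tau> :: "nat \<Rightarrow> int"
    and P Q :: "(nat \<Rightarrow> real) \<times> (nat \<Rightarrow> real)"
  assumes "closed V" and "k \<ge> 1"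
    and "F \<in> tuples V k \<rightarrow> V" and "continuous_on (tuples V k) F"
    and "diagonal_extension V k (shift_map k F) G"
    and "\<tau> \<in> {1..k} \<rightarrow> {-1, 1}"
    and "monotone_on (tuples V k \<times> tuples V k) (le_lambda k \<tau>) (le_lambda k \<tau>) G"
    and "P \<in> tuples V k \<times> tuples V k" and "Q \<in> tuples V k \<times> tuples V k"
    and "le_lambda k \<tau> P (G P)" and "le_lambda k \<tau> (G Q) Q"
    and "\<exists>!Z. Z \<in> order_interval V k \<tau> P Q \<and> G Z = Z"
  shows "\<forall>X\<^sub>0\<in>tuples V k. le_lambda k \<tau> P (X\<^sub>0, X\<^sub>0) \<and> le_lambda k \<tau> (X\<^sub>0, X\<^sub>0) Q \<longrightarrow>
           (\<exists>L\<in>tuples V k \<times> tuples V k. (\<lambda>n. (G ^^ n) (X\<^sub>0, X\<^sub>0)) \<longlonglongrightarrow> L) \<and>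
           (\<forall>x. solves_recurrence k F X\<^sub>0 x \<longrightarrow>
              (\<exists>l. fixed_point_of V k F l \<and> (\<lambda>n. x (int n)) \<longlonglongrightarrow> l))"
proof (intro ballI impI)
  let ?T = "shift_map k F" and ?VV = "tuples V k \<times> tuples V k"
  have G: "G \<in> ?VV \<rightarrow> ?VV" and diag: "\<And>X. X \<in> tuples V k \<Longrightarrow> G (X, X) = (?T X, ?T X)"
    using assms(5) by (simp_all add: diagonal_extension_def)
  have monoD: "le_lambda k \<tau> (G Z) (G W)" if "Z \<in> ?VV" "W \<in> ?VV" "le_lambda k \<tau> Z W" for Z W
    using assms(7) that by (rule monotone_onD)
  fix X\<^sub>0 assume X0: "X\<^sub>0 \<in> tuples V k"
  assume PQ0: "le_lambda k \<tau> P (X\<^sub>0, X\<^sub>0) \<and> le_lambda k \<tau> (X\<^sub>0, X\<^sub>0) Q"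
  define y where "y n = (?T ^^ n) X\<^sub>0" for n
  have y_Suc: "y (Suc n) = ?T (y n)" for n
    by (simp add: y_def)
  have yV: "y n \<in> tuples V k" for n
    by (induction n) (simp_all add: y_Suc shift_map_in_tuples[OF assms(3)], simp add: y_def X0)
  have G_y: "(G ^^ n) (X\<^sub>0, X\<^sub>0) = (y n, y n)" for n
    by (induction n) (simp_all add: y_Suc diag yV, simp add: y_def)
  have Py: "le_lambda k \<tau> P (y n, y n)" for n
  proof (induction n)
    case 0
    then show ?case using PQ0 by (simp add: y_def)
  next
    case (Suc n)
    then show ?case
      using le_lambda_trans[OF assms(10) monoD[OF assms(8) _ Suc]] yV by (simp add: diag y_Suc)
  qed
  have yQ: "le_lambda k \<tau> (y n, y n) Q" for n
  proof (induction n)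
    case 0
    then show ?case using PQ0 by (simp add: y_def)
  next
    case (Suc n)
    then show ?case
      using le_lambda_trans[OF monoD[OF _ assms(9) Suc] assms(11)] yV by (simp add: diag y_Suc)
  qed

  \<comment> \<open>The first components of \<open>P\<close> and \<open>Q\<close> bound every
    coordinate of the orbit. Which one is the left endpoint depends on \<open>\<tau> i\<close>,
    hence \<open>min\<close> and \<open>max\<close>.\<close>
  define K where
    "K = (\<Pi>\<^sub>E i\<in>{1..k}. V \<inter> {min (fst P i) (fst Q i)..max (fst P i) (fst Q i)})"
  have "compact K"
    unfolding K_def by (intro compact_PiE closed_Int_compact assms(1) compact_Icc)
  have yK: "y n \<in> K" for n
  proof -
    have "y n i \<in> {min (fst P i) (fst Q i)..max (fst P i) (fst Q i)}" if "i \<in> {1..k}" for i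
    proof -
      have "\<tau> i = 1 \<or> \<tau> i = -1"
        using assms(6) that by blast
      then show ?thesis
        using Py[of n] yQ[of n] that by (fastforce simp: le_lambda_def le_tau_def)
    qed
    then show ?thesis
      using yV[of n] by (auto simp: K_def tuples_def PiE_iff)
  qed
  have "K \<subseteq> tuples V k"
    by (auto simp: K_def tuples_def)
  have K: "seq_compact K" "closed K"
    using \<open>compact K\<close> by (simp_all add: compact_imp_seq_compact compact_imp_closed)
  have contT: "continuous_on K ?T"
    using continuous_on_shift_map[OF assms(4)] \<open>K \<subseteq> tuples V k\<close> continuous_on_subset by blast

  define \<Omega> where "\<Omega> = subseq_limits y"
  have \<Omega>V: "\<Omega> \<subseteq> tuples V k"
    using subseq_limits_subset[of K y, OF K(2) yK] \<open>K \<subseteq> tuples V k\<close> by (auto simp: \<Omega>_def)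
  have \<Omega>T: "\<Omega> \<subseteq> ?T ` \<Omega>"
    unfolding \<Omega>_def by (rule subseq_limits_preimage[of K y ?T, OF K yK contT y_Suc])
  have \<Omega>PQ: "le_lambda k \<tau> P (w, w)" "le_lambda k \<tau> (w, w) Q" if w: "w \<in> \<Omega>" for w
  proof -
    obtain r where r: "(y \<circ> r) \<longlonglongrightarrow> w"
      using w by (auto simp: \<Omega>_def subseq_limits_def)
    show "le_lambda k \<tau> P (w, w)" "le_lambda k \<tau> (w, w) Q"
      \<comment> \<open>Each \<open>le_lambda\<close> bound constrains \<open>w\<close> from both
        sides in \<open>le_tau\<close>; the instance with negated \<open>\<tau>\<close> handles the
        upper bounds.\<close>
      using Py yQ le_tau_lim[OF r, of k \<tau>] le_tau_lim[OF r, of k "\<lambda>i. - \<tau> i"]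
      by (auto simp: le_lambda_def le_tau_uminus)
  qed
  obtain z where z: "z \<in> \<Omega>"
    using seq_compact_imp_subseq_limit[of K y, OF K(1) yK strict_mono_id] by (auto simp: \<Omega>_def)
  define D where "D = (\<lambda>w. (w, w)) ` \<Omega>"
  have D: "D \<subseteq> ?VV" "D \<noteq> {}" "D \<subseteq> G ` D"
  proof -
    show "D \<subseteq> ?VV" "D \<noteq> {}"
      using \<Omega>V z by (auto simp: D_def)
    show "D \<subseteq> G ` D"
    proof
      fix W assume "W \<in> D"
      then obtain w where w: "w \<in> \<Omega>" "W = (?T w, ?T w)"
        using \<Omega>T by (auto simp: D_def)
      then have "W = G (w, w)"
        using diag \<Omega>V by auto
      then show "W \<in> G ` D"
        using w(1) by (simp add: D_def)
    qed
  qed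
  have DPQ: "\<And>W. W \<in> D \<Longrightarrow> le_lambda k \<tau> P W" "\<And>W. W \<in> D \<Longrightarrow> le_lambda k \<tau> W Q"
    using \<Omega>PQ by (auto simp: D_def)
  obtain Z where Z: "Z \<in> ?VV" "G Z = Z" "le_lambda k \<tau> P Z" "\<And>W. W \<in> D \<Longrightarrow> le_lambda k \<tau> Z W"
    using fixed_point_below[OF assms(1,6) G assms(7,8,10) D DPQ(1)] by blast
  obtain Z' where Z': "Z' \<in> ?VV" "G Z' = Z'" "le_lambda k \<tau> Z' Q"
      "\<And>W. W \<in> D \<Longrightarrow> le_lambda k \<tau> W Z'"
    using fixed_point_above[OF assms(1,6) G assms(7,9,11) D DPQ(2)] by blast
  have "(z, z) \<in> D"
    using z by (simp add: D_def)
  \<comment> \<open>The point \<open>(z, z)\<close> separates the two fixed points. With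
    \<open>P \<le> Z\<close> and \<open>Z' \<le> Q\<close> this puts both in the order interval,
    where uniqueness identifies them.\<close>
  have "le_lambda k \<tau> Z Z'"
    using le_lambda_trans Z(4) Z'(4) \<open>(z, z) \<in> D\<close> by blast
  then have "Z \<in> order_interval V k \<tau> P Q" "Z' \<in> order_interval V k \<tau> P Q"
    using Z Z' le_lambda_trans unfolding order_interval_def by blast+
  then have "Z' = Z"
    using assms(12) Z(2) Z'(2) by blast
  have D_Z: "W = Z" if "W \<in> D" for W
    using le_lambda_antisym[OF assms(6) _ Z(1)] Z(4) Z'(4) that D(1) \<open>Z' = Z\<close> by blast
  have Zz: "Z = (z, z)"
    using D_Z \<open>(z, z) \<in> D\<close> by blast
  have "\<Omega> \<subseteq> {z}"
    using D_Z Zz by (auto simp: D_def)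
  then have lim: "y \<longlonglongrightarrow> z"
    using tendsto_if_subseq_limits_singleton[of K y, OF K(1) yK] by (simp add: \<Omega>_def)
  have zV: "z \<in> tuples V k"
    using z \<Omega>V by blast
  have Tz: "?T z = z"
    using Z(2) diag[OF zV] by (simp add: Zz)
  \<comment> \<open>Comparing coordinates in \<open>?T z = z\<close> gives
    \<open>z (Suc i) = z i\<close> for \<open>i \<ge> 1\<close>, so a fixed point of the shift map
    is constant.\<close>
  have z_const: "z i = z 1" if "i \<in> {1..k}" for i
    using that
  proof (induction i)
    case (Suc i)
    then show ?case
      using fun_cong[OF Tz, of "Suc i"] by (cases "i = 0") (auto simp: shift_map_def)
  qed simp
  have "z = (\<lambda>i\<in>{1..k}. z 1)"
  proof (rule extensionalityI[of _ "{1..k}"])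
    show "z \<in> extensional {1..k}"
      using zV by (simp add: tuples_def PiE_iff)
    show "z i = (\<lambda>i\<in>{1..k}. z 1) i" if "i \<in> {1..k}" for i
      using z_const[OF that] that by simp
  qed simp
  moreover have "F z = z 1"
    using fun_cong[OF Tz, of 1] assms(2) by (simp add: shift_map_def)
  moreover have "z 1 \<in> V"
    using zV assms(2) unfolding tuples_def by (auto dest: PiE_mem[where x = 1])
  ultimately have fixed: "fixed_point_of V k F (z 1)"
    by (simp add: fixed_point_of_def)

  show "(\<exists>L\<in>?VV. (\<lambda>n. (G ^^ n) (X\<^sub>0, X\<^sub>0)) \<longlonglongrightarrow> L) \<and>
      (\<forall>x. solves_recurrence k F X\<^sub>0 x \<longrightarrow>
        (\<exists>l. fixed_point_of V k F l \<and> (\<lambda>n. x (int n)) \<longlonglongrightarrow> l))"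
  proof (intro conjI allI impI)
    show "\<exists>L\<in>?VV. (\<lambda>n. (G ^^ n) (X\<^sub>0, X\<^sub>0)) \<longlonglongrightarrow> L"
      using zV tendsto_Pair[OF lim lim] by (auto simp: G_y)
    fix x assume x: "solves_recurrence k F X\<^sub>0 x"
    \<comment> \<open>Coordinates run backwards in time: coordinate \<open>i\<close> of
      \<open>y n\<close> is the term of index \<open>n + 1 - i\<close>. In particular coordinate 1
      is \<open>x n\<close>, so the limit of the recurrence is \<open>z 1\<close>.\<close>
    have y_x: "y n = (\<lambda>i\<in>{1..k}. x (int n + 1 - int i))" for n
    proof (induction n)
      case 0
      then show ?case
        using x by (simp add: solves_recurrence_def y_def)
    next
      case (Suc n)
      have "x (int n + 1) = F (y n)"
        using x unfolding Suc solves_recurrence_def by simp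
      then show ?case
        unfolding y_Suc
        unfolding shift_map_def
        by (intro restrict_ext) (auto simp: Suc of_nat_diff algebra_simps)
    qed
    have "(\<lambda>n. x (int n)) \<longlonglongrightarrow> z 1"
      using tendsto_coordinate[OF lim, of 1] assms(2) by (simp add: y_x)
    then show "\<exists>l. fixed_point_of V k F l \<and> (\<lambda>n. x (int n)) \<longlonglongrightarrow> l"
      using fixed by blast
  qed
qed

end
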